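(* Let $w=\{w_n\}_{n\in\mathbb{Z}}$ be a bounded sequence of non-zero complex numbers such that $$\liminf_{n\to+\infty}\widetilde w(1-n,0)^{1/n}=0.$$ Then the weighted bilateral shift $T_{w,p}$ is cyclic for every $p$ with $1\leq p\leq\infty$.
   Context: All vector spaces are over $\mathbb{C}$; $\mathbb{Z}_+$ is the set of non-negative integers. For integers $a\leq b$, $\widetilde w(a,b)=\prod_{j=a}^{b}|w_j|$. For a bounded sequence $w$ of non-zero complex numbers, the weighted bilateral shift $T_{w,p}$ is the bounded linear operator acting on $\ell_p(\mathbb{Z})$ if $1\leq p<\infty$, and on $c_0(\mathbb{Z})$ if $p=\infty$, defined on the canonical basis by $T_{w,p}e_n=w_ne_{n-1}$ for $n\in\mathbb{Z}$. A bounded linear operator $T$ on a Banach space $\mathcal{B}$ is cyclic if there is $x\in\mathcal{B}$ such that the linear span of $\{T^nx:n\in\mathbb{Z}_+\}$ is dense in $\mathcal{B}$. *)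

theory Defs
  imports "HOL-Analysis.Analysis" "HOL-Library.Function_Algebras"
begin

text \<open>
  Complex sequences indexed by the integers, with the pointwise additive structure of
  \<open>Function_Algebras\<close>.  Since the exponent \<open>p\<close> is a value, the spaces are carrier sets
  together with a norm, not types.
\<close>

definition cscale :: "complex \<Rightarrow> (int \<Rightarrow> complex) \<Rightarrow> int \<Rightarrow> complex"
  where "cscale c x = (\<lambda>n. c * x n)"

lemma vector_space_cscale: "vector_space cscale"
  by unfold_locales (auto simp: cscale_def fun_eq_iff algebra_simps)

text \<open>
  For \<open>p = \<infinity>\<close> the space is \<open>c\<^sub>0(\<int>)\<close>, not \<open>\<ell>\<^sub>\<infinity>(\<int>)\<close>; on the integers the filter
  \<open>cofinite\<close> describes \<open>\<bar>n\<bar> \<rightarrow> \<infinity>\<close>.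
\<close>

definition seq_space :: "ereal \<Rightarrow> (int \<Rightarrow> complex) set"
  where "seq_space p =
    (if p = \<infinity> then {x. (x \<longlongrightarrow> 0) cofinite}
     else {x. (\<lambda>n. cmod (x n) powr real_of_ereal p) summable_on UNIV})"

definition seq_norm :: "ereal \<Rightarrow> (int \<Rightarrow> complex) \<Rightarrow> real"
  where "seq_norm p x =
    (if p = \<infinity> then (SUP n. cmod (x n))
     else (\<Sum>\<^sub>\<infinity>n. cmod (x n) powr real_of_ereal p) powr (1 / real_of_ereal p))"

definition unit_seq :: "int \<Rightarrow> int \<Rightarrow> complex"
  where "unit_seq k = (\<lambda>n. if n = k then 1 else 0)"

definition bounded_operator_on ::
    "(int \<Rightarrow> complex) set \<Rightarrow> ((int \<Rightarrow> complex) \<Rightarrow> real) \<Rightarrow> ((int \<Rightarrow> complex) \<Rightarrow> int \<Rightarrow> complex) \<Rightarrow> bool"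
  where "bounded_operator_on V nrm T \<longleftrightarrow>
    T ` V \<subseteq> V \<and>
    (\<forall>x\<in>V. \<forall>y\<in>V. T (x + y) = T x + T y) \<and>
    (\<forall>c. \<forall>x\<in>V. T (cscale c x) = cscale c (T x)) \<and>
    (\<exists>C. \<forall>x\<in>V. nrm (T x) \<le> C * nrm x)"

definition cyclic_on ::
    "(int \<Rightarrow> complex) set \<Rightarrow> ((int \<Rightarrow> complex) \<Rightarrow> real) \<Rightarrow> ((int \<Rightarrow> complex) \<Rightarrow> int \<Rightarrow> complex) \<Rightarrow> bool"
  where "cyclic_on V nrm T \<longleftrightarrow>
    (\<exists>x\<in>V. \<forall>y\<in>V. \<forall>\<epsilon>>0. \<exists>z\<in>module.span cscale (range (\<lambda>n. (T ^^ n) x)). nrm (y - z) < \<epsilon>)"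

definition wtilde :: "(int \<Rightarrow> complex) \<Rightarrow> int \<Rightarrow> int \<Rightarrow> real"
  where "wtilde w a b = (\<Prod>j\<in>{a..b}. cmod (w j))"

text \<open>
  The coordinate formula for the operator with \<open>T e\<^sub>n = w\<^sub>n e\<^sub>n\<^sub>-\<^sub>1\<close>.  The theorems
  \<open>bounded_operator_on_weighted_shift\<close>, \<open>weighted_shift_unit_seq\<close> and
  \<open>weighted_shift_unique\<close> below show that it is the unique bounded operator on
  \<open>seq_space p\<close> acting in this way on the canonical basis.
\<close>

definition weighted_shift :: "(int \<Rightarrow> complex) \<Rightarrow> (int \<Rightarrow> complex) \<Rightarrow> int \<Rightarrow> complex"
  where "weighted_shift w x = (\<lambda>n. w (n + 1) * x (n + 1))"

theorem weighted_shift_unit_seq: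
  "weighted_shift w (unit_seq n) = cscale (w n) (unit_seq (n - 1))"
  by (auto simp: weighted_shift_def unit_seq_def cscale_def fun_eq_iff)

lemma exponent_cases:
  assumes "1 \<le> (p::ereal)"
  obtains "p = \<infinity>" | r where "p = ereal r" "1 \<le> r"
  using assms by (cases p) auto

lemma seq_space_add:
  assumes p: "1 \<le> p" and x: "x \<in> seq_space p" and y: "y \<in> seq_space p"
  shows "x + y \<in> seq_space p"
  using p
proof (cases rule: exponent_cases)
  case 1
  with x y show ?thesis
    using tendsto_add[of x 0 cofinite y 0] by (simp add: seq_space_def plus_fun_def)
next
  case (2 r)
  have s: "(\<lambda>n. 2 powr r * (cmod (x n) powr r + cmod (y n) powr r)) summable_on UNIV"
    using x y 2 by (intro summable_on_cmult_right summable_on_add) (auto simp: seq_space_def)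
  have "cmod (x n + y n) powr r \<le> 2 powr r * (cmod (x n) powr r + cmod (y n) powr r)" for n
  proof -
    have "cmod (x n + y n) powr r \<le> (2 * max (cmod (x n)) (cmod (y n))) powr r"
      using 2 norm_triangle_ineq[of "x n" "y n"] by (intro powr_mono2) (auto simp: max_def)
    also have "\<dots> = 2 powr r * max (cmod (x n)) (cmod (y n)) powr r"
      by (simp add: powr_mult)
    also have "\<dots> \<le> 2 powr r * (cmod (x n) powr r + cmod (y n) powr r)"
      by (auto simp: max_def)
    finally show ?thesis .
  qed
  with s have "(\<lambda>n. cmod (x n + y n) powr r) summable_on UNIV"
    by (intro summable_on_comparison_test[OF s]) auto
  with 2 show ?thesis by (simp add: seq_space_def)
qed

lemma seq_space_cscale:
  assumes p: "1 \<le> p" and x: "x \<in> seq_space p"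
  shows "cscale c x \<in> seq_space p"
  using p
proof (cases rule: exponent_cases)
  case 1
  with x show ?thesis
    using tendsto_mult_right_zero[of x cofinite c] by (simp add: seq_space_def cscale_def)
next
  case (2 r)
  with x show ?thesis
    by (auto simp: seq_space_def cscale_def norm_mult powr_mult intro!: summable_on_cmult_right)
qed

lemma subspace_seq_space:
  assumes "1 \<le> p" shows "module.subspace cscale (seq_space p)"
proof -
  interpret vector_space cscale by (rule vector_space_cscale)
  have "0 \<in> seq_space p"
    by (simp add: seq_space_def zero_fun_def)
  then show ?thesis
    using assms by (auto simp: subspace_def intro: seq_space_add seq_space_cscale)
qed

lemma c0_bdd_above:
  fixes x :: "int \<Rightarrow> complex"
  assumes "(x \<longlongrightarrow> 0) cofinite"
  shows "bdd_above (range (\<lambda>n. cmod (x n)))"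
proof -
  have "\<forall>\<^sub>F n in cofinite. cmod (x n) < 1"
    using tendstoD[OF assms, of 1] by (simp add: dist_norm)
  then have "finite {n. \<not> cmod (x n) < 1}"
    by (simp add: eventually_cofinite)
  then have "bdd_above ((\<lambda>n. cmod (x n)) ` {n. \<not> cmod (x n) < 1} \<union> {..1})"
    by simp
  then show ?thesis
    by (rule bdd_above_mono) auto
qed

lemma norm_coordinate_le:
  assumes p: "1 \<le> p" and x: "x \<in> seq_space p"
  shows "cmod (x k) \<le> seq_norm p x"
  using p
proof (cases rule: exponent_cases)
  case 1
  with x show ?thesis
    by (auto simp: seq_space_def seq_norm_def intro!: cSUP_upper c0_bdd_above)
next
  case (2 r)
  have "cmod (x k) powr r \<le> (\<Sum>\<^sub>\<infinity>n. cmod (x n) powr r)"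
    using finite_sum_le_infsum[of "\<lambda>n. cmod (x n) powr r" UNIV "{k}"] x 2
    by (simp add: seq_space_def)
  then have "(cmod (x k) powr r) powr (1 / r) \<le> (\<Sum>\<^sub>\<infinity>n. cmod (x n) powr r) powr (1 / r)"
    using 2 by (intro powr_mono2) auto
  with 2 show ?thesis
    by (simp add: seq_norm_def powr_powr)
qed

lemma truncation:
  assumes p: "1 \<le> p" and x: "x \<in> seq_space p" and "0 < \<epsilon>"
  obtains F where "finite F" "k \<in> F"
    "(\<lambda>n. if n \<in> F then 0 else x n) \<in> seq_space p"
    "seq_norm p (\<lambda>n. if n \<in> F then 0 else x n) \<le> \<epsilon>"
  using p
proof (cases rule: exponent_cases)
  case 1
  define F where "F = insert k {n. \<not> cmod (x n) < \<epsilon>}"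
  let ?y = "\<lambda>n. if n \<in> F then 0 else x n"
  have lim: "(x \<longlongrightarrow> 0) cofinite"
    using x 1 by (simp add: seq_space_def)
  have "\<forall>\<^sub>F n in cofinite. cmod (x n) < \<epsilon>"
    using tendstoD[OF lim \<open>0 < \<epsilon>\<close>] by (simp add: dist_norm)
  then have F: "finite F"
    by (simp add: F_def eventually_cofinite)
  have "(?y \<longlongrightarrow> 0) cofinite"
    by (rule Lim_null_comparison[OF _ tendsto_norm_zero[OF lim]]) simp
  moreover have "(SUP n. cmod (?y n)) \<le> \<epsilon>"
    using \<open>0 < \<epsilon>\<close> by (intro cSUP_least) (auto simp: F_def)
  ultimately show ?thesis
    using F 1 by (intro that[of F]) (auto simp: seq_space_def seq_norm_def F_def)
next
  case (2 r)
  let ?f = "\<lambda>n. cmod (x n) powr r"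
  have s: "?f summable_on UNIV"
    using x 2 by (simp add: seq_space_def)
  obtain F0 where F0: "finite F0" "dist (sum ?f F0) (infsum ?f UNIV) \<le> \<epsilon> powr r"
    using infsum_finite_approximation[OF s, of "\<epsilon> powr r"] \<open>0 < \<epsilon>\<close> by auto
  define F where "F = insert k F0"
  have F: "finite F" using F0 by (simp add: F_def)
  let ?y = "\<lambda>n. if n \<in> F then 0 else x n"
  have eq: "(\<lambda>n. cmod (?y n) powr r) = (\<lambda>n. if n \<in> - F then ?f n else 0)"
    using 2 by (auto simp: fun_eq_iff)
  have sF: "?f summable_on (- F)"
    using s by (rule summable_on_subset_banach) simp
  have sy: "(\<lambda>n. cmod (?y n) powr r) summable_on UNIV"
  proof -
    have "(\<lambda>n. if n \<in> - F then ?f n else 0) summable_on UNIV \<longleftrightarrow> ?f summable_on (- F)"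
      by (rule summable_on_cong_neutral) auto
    then show ?thesis using sF eq by simp
  qed
  have "(\<Sum>\<^sub>\<infinity>n. cmod (?y n) powr r) = infsum ?f (- F)"
    unfolding eq by (rule infsum_cong_neutral) auto
  also have "\<dots> = infsum ?f UNIV - sum ?f F"
    using infsum_Diff[of ?f UNIV F] s F by (simp add: Compl_eq_Diff_UNIV)
  also have "\<dots> \<le> infsum ?f UNIV - sum ?f F0"
    using F by (intro diff_left_mono sum_mono2) (auto simp: F_def)
  also have "\<dots> \<le> \<epsilon> powr r"
    using F0(2) by (simp add: dist_real_def abs_le_iff)
  finally have "(\<Sum>\<^sub>\<infinity>n. cmod (?y n) powr r) powr (1 / r) \<le> (\<epsilon> powr r) powr (1 / r)"
    using 2 by (intro powr_mono2 infsum_nonneg) auto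
  then have "(\<Sum>\<^sub>\<infinity>n. cmod (?y n) powr r) powr (1 / r) \<le> \<epsilon>"
    using 2 \<open>0 < \<epsilon>\<close> by (simp add: powr_powr)
  with sy F 2 show ?thesis
    by (intro that[of F]) (auto simp: seq_space_def seq_norm_def F_def)
qed

theorem bounded_operator_on_weighted_shift:
  assumes w: "bounded (range w)" and p: "1 \<le> p"
  shows "bounded_operator_on (seq_space p) (seq_norm p) (weighted_shift w)"
proof -
  obtain W where W: "cmod (w n) \<le> W" "0 \<le> W" for n
    using w by (auto simp: bounded_pos) (metis less_imp_le)
  have le: "cmod (weighted_shift w x n) \<le> W * cmod (x (n + 1))" for x n
    using W by (simp add: weighted_shift_def norm_mult mult_right_mono)
  have "weighted_shift w x \<in> seq_space p \<and>
      seq_norm p (weighted_shift w x) \<le> W * seq_norm p x" if x: "x \<in> seq_space p" for x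
    using p
  proof (cases rule: exponent_cases)
    case 1
    have lim: "(x \<longlongrightarrow> 0) cofinite"
      using x 1 by (simp add: seq_space_def)
    have "filterlim (\<lambda>n::int. n + 1) cofinite cofinite"
      unfolding filterlim_iff eventually_cofinite
    proof (intro allI impI)
      fix P :: "int \<Rightarrow> bool" assume "finite {n. \<not> P n}"
      then have "finite ((\<lambda>n. n + 1) -` {n. \<not> P n})"
        by (rule finite_vimageI) (simp add: inj_on_def)
      then show "finite {n. \<not> P (n + 1)}" by (simp add: vimage_def)
    qed
    then have "((\<lambda>n. x (n + 1)) \<longlongrightarrow> 0) cofinite"
      by (rule filterlim_compose[OF lim])
    then have "((\<lambda>n. W * cmod (x (n + 1))) \<longlongrightarrow> 0) cofinite"
      by (intro tendsto_mult_right_zero tendsto_norm_zero)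
    then have "(weighted_shift w x \<longlongrightarrow> 0) cofinite"
      by (rule Lim_null_comparison[rotated]) (use le in auto)
    moreover have "(SUP n. cmod (weighted_shift w x n)) \<le> W * (SUP n. cmod (x n))"
    proof (rule cSUP_least)
      show "cmod (weighted_shift w x n) \<le> W * (SUP n. cmod (x n))" for n
        by (rule order.trans[OF le]) (intro mult_left_mono cSUP_upper c0_bdd_above lim W UNIV_I)
    qed simp
    ultimately show ?thesis
      using 1 by (simp add: seq_space_def seq_norm_def)
  next
    case (2 r)
    let ?f = "\<lambda>n. cmod (x n) powr r"
    have s: "?f summable_on UNIV"
      using x 2 by (simp add: seq_space_def)
    have bij: "bij_betw (\<lambda>n::int. n + 1) UNIV UNIV"
      by (rule bij_betw_byWitness[where f' = "\<lambda>n. n - 1"]) auto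
    have s1: "(\<lambda>n. W powr r * ?f (n + 1)) summable_on UNIV"
      using s summable_on_reindex_bij_betw[OF bij, of ?f]
      by (intro summable_on_cmult_right) simp
    have le': "cmod (weighted_shift w x n) powr r \<le> W powr r * ?f (n + 1)" for n
      using powr_mono2[OF _ _ le[of x n], of r] 2 W by (simp add: powr_mult)
    have s2: "(\<lambda>n. cmod (weighted_shift w x n) powr r) summable_on UNIV"
      by (rule summable_on_comparison_test[OF s1]) (use le' in auto)
    have "(\<Sum>\<^sub>\<infinity>n. cmod (weighted_shift w x n) powr r) \<le> (\<Sum>\<^sub>\<infinity>n. W powr r * ?f (n + 1))"
      by (rule infsum_mono[OF s2 s1]) (use le' in auto)
    also have "\<dots> = W powr r * infsum ?f UNIV"
      using infsum_reindex_bij_betw[OF bij, of ?f] by (simp add: infsum_cmult_right')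
    finally have "(\<Sum>\<^sub>\<infinity>n. cmod (weighted_shift w x n) powr r) powr (1 / r)
        \<le> (W powr r * infsum ?f UNIV) powr (1 / r)"
      using 2 by (intro powr_mono2 infsum_nonneg) auto
    also have "\<dots> = W * infsum ?f UNIV powr (1 / r)"
      using 2 W by (simp add: powr_mult powr_powr infsum_nonneg)
    finally show ?thesis
      using 2 s2 by (simp add: seq_space_def seq_norm_def)
  qed
  then show ?thesis
    by (auto simp: bounded_operator_on_def weighted_shift_def cscale_def fun_eq_iff algebra_simps)
qed

theorem weighted_shift_unique:
  assumes p: "1 \<le> p"
    and S: "bounded_operator_on (seq_space p) (seq_norm p) S"
    and basis: "\<And>n. S (unit_seq n) = cscale (w n) (unit_seq (n - 1))"
    and x: "x \<in> seq_space p"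
  shows "S x = weighted_shift w x"
proof
  fix k
  interpret V: vector_space cscale by (rule vector_space_cscale)
  have sub: "V.subspace (seq_space p)"
    by (rule subspace_seq_space[OF p])
  have unit: "unit_seq n \<in> seq_space p" for n
  proof -
    have "(\<lambda>m. if m = n then 1 else 0 :: real) summable_on UNIV"
    proof -
      have "(\<lambda>m. if m = n then 1 else 0 :: real) summable_on UNIV \<longleftrightarrow> (\<lambda>_. 1 :: real) summable_on {n}"
        by (rule summable_on_cong_neutral) auto
      then show ?thesis by simp
    qed
    moreover have "(unit_seq n \<longlongrightarrow> 0) cofinite"
      by (rule tendsto_eventually)
        (auto simp: unit_seq_def eventually_cofinite intro: finite_subset[of _ "{n}"])
    moreover have "(\<lambda>m. cmod (unit_seq n m) powr r) = (\<lambda>m. if m = n then 1 else 0 :: real)" for r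
      by (auto simp: unit_seq_def fun_eq_iff)
    ultimately show ?thesis
      by (simp add: seq_space_def)
  qed
  have Sadd: "S (a + b) = S a + S b" if "a \<in> seq_space p" "b \<in> seq_space p" for a b
    using S that by (simp add: bounded_operator_on_def)
  have Sscale: "S (cscale c a) = cscale c (S a)" if "a \<in> seq_space p" for a c
    using S that by (simp add: bounded_operator_on_def)
  obtain C where "\<forall>a\<in>seq_space p. seq_norm p (S a) \<le> C * seq_norm p a"
    using S by (auto simp: bounded_operator_on_def)
  then have C: "seq_norm p (S a) \<le> C * seq_norm p a" if "a \<in> seq_space p" for a
    using that by blast
  have zero: "0 \<in> seq_space p" by (rule V.subspace_0[OF sub])
  have S0: "S 0 = 0" using Sadd[OF zero zero] by simp
  have fin: "(\<lambda>n. if n \<in> F then x n else 0) \<in> seq_space p \<and>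
      S (\<lambda>n. if n \<in> F then x n else 0) = weighted_shift w (\<lambda>n. if n \<in> F then x n else 0)"
    if "finite F" for F
    using that
  proof (induction F)
    case empty
    have "(\<lambda>n. if n \<in> {} then x n else 0) = 0" "weighted_shift w 0 = 0"
      by (auto simp: fun_eq_iff weighted_shift_def)
    then show ?case using S0 zero by metis
  next
    case (insert a F)
    let ?y = "\<lambda>n. if n \<in> F then x n else 0"
    have eq: "(\<lambda>n. if n \<in> insert a F then x n else 0) = cscale (x a) (unit_seq a) + ?y"
      using insert.hyps by (auto simp: fun_eq_iff cscale_def unit_seq_def)
    have u: "cscale (x a) (unit_seq a) \<in> seq_space p"
      by (rule V.subspace_scale[OF sub unit])
    have "S (cscale (x a) (unit_seq a) + ?y) = cscale (x a) (cscale (w a) (unit_seq (a - 1))) + weighted_shift w ?y"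
      using Sadd[OF u] Sscale[OF unit] insert.IH basis by simp
    also have "\<dots> = weighted_shift w (cscale (x a) (unit_seq a) + ?y)"
      by (auto simp: fun_eq_iff weighted_shift_def cscale_def unit_seq_def algebra_simps)
    finally show ?case
      unfolding eq using V.subspace_add[OF sub u] insert.IH by blast
  qed
  have "cmod (S x k - weighted_shift w x k) \<le> e" if "0 < e" for e
  proof -
    define d where "d = e / (\<bar>C\<bar> + 1)"
    have d: "0 < d" using that by (simp add: d_def)
    obtain F where F: "finite F" "k + 1 \<in> F"
      and t: "(\<lambda>n. if n \<in> F then 0 else x n) \<in> seq_space p" (is "?t \<in> _")
      and tn: "seq_norm p (\<lambda>n. if n \<in> F then 0 else x n) \<le> d"
      using truncation[OF p x d] by metis
    let ?y = "\<lambda>n. if n \<in> F then x n else 0"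
    have "x = ?y + ?t" by (auto simp: fun_eq_iff)
    then have "S x = weighted_shift w ?y + S ?t"
      using Sadd[of ?y ?t] fin[OF F(1)] t by metis
    then have "S x k - weighted_shift w x k = S ?t k"
      using F(2) by (simp add: weighted_shift_def)
    also have "cmod (S ?t k) \<le> seq_norm p (S ?t)"
      using S t by (intro norm_coordinate_le[OF p]) (auto simp: bounded_operator_on_def)
    also have "\<dots> \<le> C * seq_norm p ?t" by (rule C[OF t])
    also have "\<dots> \<le> (\<bar>C\<bar> + 1) * d"
      using tn d norm_coordinate_le[OF p t, of k]
      by (intro mult_mono) (auto intro: order.trans[OF norm_ge_zero])
    also have "\<dots> = e" by (simp add: d_def)
    finally show ?thesis .
  qed
  then have "cmod (S x k - weighted_shift w x k) \<le> 0"
    by (rule field_le_epsilon[of _ 0, simplified])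
  then show "S x k = weighted_shift w x k" by simp
qed

end

theory Submission
  imports Defs
begin

text \<open>
  Write \<open>T\<close> for the weighted shift and \<open>S\<close> for its formal inverse, the forward shift
  \<open>S e\<^sub>n = e\<^sub>n\<^sub>+\<^sub>1 / w\<^sub>n\<^sub>+\<^sub>1\<close>, which is usually unbounded.  The cyclic vector is
  \<open>x = \<Prod>\<^sub>s\<^sub>\<ge>\<^sub>0 (1 + \<mu>\<^sub>s S) e\<^sub>0\<close> with positive \<open>\<mu>\<^sub>s\<close> that tend to \<open>0\<close> extremely fast.
  For its tails \<open>x\<^sub>K = \<Prod>\<^sub>s\<^sub>\<ge>\<^sub>K (1 + \<mu>\<^sub>s S) e\<^sub>0\<close> put \<open>x\<^sub>k\<^sub>,\<^sub>K = S\<^sup>k x\<^sub>K\<close> (\<open>tail_vector\<close>); the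
  rates \<open>\<mu>\<^sub>s\<close> are so small that \<open>x\<^sub>k\<^sub>,\<^sub>K\<close> is absolutely summable for \<open>k \<le> K\<close>.  The proof
  rests on three facts about these vectors.

  First, peeling off one factor of the product gives
  \<open>x\<^sub>k\<^sub>,\<^sub>K = (T + \<mu>\<^sub>K) x\<^sub>k\<^sub>+\<^sub>1\<^sub>,\<^sub>K\<^sub>+\<^sub>1\<close> (\<open>tail_vector_factor\<close>).

  Second, such a factor can be cancelled inside the closed linear span \<open>E\<close> of the orbit of
  \<open>x\<close> (\<open>l1_closure_cancel_factor\<close>).  If \<open>(T - \<mu>) y\<close> lies in \<open>E\<close>, then so does
  \<open>(T\<^sup>n - \<mu>\<^sup>n) y\<close>, which is a polynomial in \<open>T\<close> applied to it, and hence so does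
  \<open>y - \<mu>\<^sup>-\<^sup>n T\<^sup>n y\<close>.  If \<open>\<mu>\<^sup>-\<^sup>n T\<^sup>n y\<close> is arbitrarily small for suitable \<open>n\<close>, it follows
  that \<open>y\<close> itself is in \<open>E\<close>.

  Third, the hypothesis on \<open>w\<close> supplies this smallness for every \<open>\<mu> \<noteq> 0\<close> and
  \<open>y = x\<^sub>k\<^sub>,\<^sub>K\<close> (\<open>tail_vector_orbit_small\<close>).  It says that \<open>T\<^sup>m e\<^sub>0\<close> is smaller than any
  given geometric rate for some large \<open>m\<close>.  Boundedness of \<open>T\<close> spreads this to all
  \<open>T\<^sup>j e\<^sub>0\<close> with \<open>m \<le> j \<le> 2 m\<close>, and the remaining part of \<open>T\<^sup>2\<^sup>m x\<^sub>K\<close> is controlled by the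
  superexponential decay of the coefficients of \<open>x\<^sub>K\<close>.

  Together these give \<open>x\<^sub>K\<^sub>,\<^sub>K \<in> E\<close> for all \<open>K\<close>, by induction from \<open>x\<^sub>0\<^sub>,\<^sub>0 = x\<close>.  Applying \<open>T\<close> yields
  \<open>x\<^sub>k\<^sub>,\<^sub>K \<in> E\<close> for all \<open>k \<le> K\<close>, and as \<open>K \<rightarrow> \<infinity>\<close> these vectors converge to a non-zero
  multiple of \<open>e\<^sub>k\<close>.  So \<open>E\<close> contains every basis vector (\<open>unit_seq_in_orbit_closure\<close>).

  All approximations up to this point are made in the \<open>\<ell>\<^sub>1\<close> norm, which dominates the norm
  of \<open>seq_space p\<close> for every \<open>p\<close>.  One and the same \<open>x\<close> is therefore cyclic for all \<open>p\<close>,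
  and \<open>p\<close> enters only when a vector of \<open>seq_space p\<close> is approximated by its truncations.
\<close>

section \<open>Absolutely summable sequences\<close>

text \<open>
  Bounding all finite partial sums states summability and the size of the sum at once.
\<close>

definition l1_le :: "(int \<Rightarrow> complex) \<Rightarrow> real \<Rightarrow> bool"
  where "l1_le x b \<longleftrightarrow> (\<forall>F. finite F \<longrightarrow> (\<Sum>n\<in>F. cmod (x n)) \<le> b)"

lemma l1_le_mono: "l1_le x a \<Longrightarrow> a \<le> b \<Longrightarrow> l1_le x b"
  unfolding l1_le_def by (meson order_trans)

lemma l1_le_nonneg: "l1_le x b \<Longrightarrow> 0 \<le> b"
  unfolding l1_le_def by (metis finite.emptyI sum.empty)

lemma l1_le_zero: "0 \<le> b \<Longrightarrow> l1_le 0 b"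
  by (simp add: l1_le_def)

lemma l1_le_add:
  assumes "l1_le x a" "l1_le y b"
  shows "l1_le (x + y) (a + b)"
  unfolding l1_le_def
proof (intro allI impI)
  fix F :: "int set" assume F: "finite F"
  have "(\<Sum>n\<in>F. cmod ((x + y) n)) \<le> (\<Sum>n\<in>F. cmod (x n) + cmod (y n))"
    by (intro sum_mono) (simp add: norm_triangle_ineq)
  also have "\<dots> \<le> a + b"
    using assms F by (auto simp: l1_le_def sum.distrib intro: add_mono)
  finally show "(\<Sum>n\<in>F. cmod ((x + y) n)) \<le> a + b" .
qed

lemma l1_le_cscale:
  assumes "l1_le x a"
  shows "l1_le (cscale c x) (cmod c * a)"
  using assms
  by (auto simp: l1_le_def cscale_def norm_mult simp flip: sum_distrib_left intro: mult_left_mono)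

lemma l1_le_weighted_shift:
  assumes x: "l1_le x a" and C: "\<And>n. cmod (w n) \<le> C" "0 \<le> C"
  shows "l1_le (weighted_shift w x) (C * a)"
  unfolding l1_le_def
proof (intro allI impI)
  fix F :: "int set" assume F: "finite F"
  have "(\<Sum>n\<in>F. cmod (weighted_shift w x n)) \<le> (\<Sum>n\<in>F. C * cmod (x (n + 1)))"
    by (intro sum_mono) (simp add: weighted_shift_def norm_mult mult_right_mono C)
  also have "\<dots> = C * (\<Sum>n\<in>(\<lambda>n. n + 1) ` F. cmod (x n))"
    by (subst sum.reindex) (auto simp: sum_distrib_left)
  also have "\<dots> \<le> C * a"
    using x F C by (intro mult_left_mono) (auto simp: l1_le_def)
  finally show "(\<Sum>n\<in>F. cmod (weighted_shift w x n)) \<le> C * a" .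
qed

lemma l1_leI_from:
  fixes g :: "nat \<Rightarrow> real"
  assumes g: "summable g" "\<And>l. 0 \<le> g l"
    and zero: "\<And>n. n < k \<Longrightarrow> x n = 0"
    and le: "\<And>l. cmod (x (k + int l)) \<le> g l"
  shows "l1_le x (suminf g)"
  unfolding l1_le_def
proof (intro allI impI)
  fix F :: "int set" assume F: "finite F"
  have "(\<Sum>n\<in>F. cmod (x n)) = (\<Sum>n\<in>{n\<in>F. k \<le> n}. cmod (x n))"
    using F zero by (intro sum.mono_neutral_right) (auto simp: not_le)
  also have "\<dots> \<le> (\<Sum>n\<in>{n\<in>F. k \<le> n}. g (nat (n - k)))"
  proof (rule sum_mono)
    fix n assume "n \<in> {n\<in>F. k \<le> n}"
    then show "cmod (x n) \<le> g (nat (n - k))"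
      using le[of "nat (n - k)"] by simp
  qed
  also have "\<dots> = sum g ((\<lambda>n. nat (n - k)) ` {n\<in>F. k \<le> n})"
    by (subst sum.reindex) (auto simp: inj_on_def)
  also have "\<dots> \<le> suminf g"
    using F g by (intro sum_le_suminf) auto
  finally show "(\<Sum>n\<in>F. cmod (x n)) \<le> suminf g" .
qed

lemma l1_le_tendsto_0:
  assumes "l1_le x b"
  shows "(x \<longlongrightarrow> 0) cofinite"
proof (rule tendstoI)
  fix \<epsilon> :: real assume "0 < \<epsilon>"
  have "finite {n. \<epsilon> \<le> cmod (x n)}"
  proof (rule finite_if_finite_subsets_card_bdd[of _ "nat \<lceil>b / \<epsilon>\<rceil>", THEN conjunct1])
    fix F assume F: "F \<subseteq> {n. \<epsilon> \<le> cmod (x n)}" "finite F"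
    have "real (card F) * \<epsilon> \<le> (\<Sum>n\<in>F. cmod (x n))"
      using F by (intro sum_bounded_below) auto
    also have "\<dots> \<le> b"
      using assms F by (simp add: l1_le_def)
    finally have "real (card F) \<le> b / \<epsilon>"
      using \<open>0 < \<epsilon>\<close> by (simp add: field_simps)
    then show "card F \<le> nat \<lceil>b / \<epsilon>\<rceil>"
      by linarith
  qed
  then show "\<forall>\<^sub>F n in cofinite. dist (x n) 0 < \<epsilon>"
    by (simp add: eventually_cofinite not_less)
qed

text \<open>
  For finite \<open>p = r\<close> every coordinate is at most \<open>b\<close>, so that
  \<open>\<bar>x\<^sub>n\<bar>\<^sup>r \<le> \<bar>x\<^sub>n\<bar> b\<^sup>r\<^sup>-\<^sup>1\<close>, and these bounds sum to at most \<open>b\<^sup>r\<close>.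
\<close>

lemma l1_le_imp_seq_norm_le:
  assumes x: "l1_le x b" and p: "1 \<le> p"
  shows "x \<in> seq_space p \<and> seq_norm p x \<le> b"
  using p
proof (cases rule: exponent_cases)
  case 1
  have "cmod (x n) \<le> b" for n
    using x[unfolded l1_le_def, rule_format, of "{n}"] by simp
  then have "(SUP n. cmod (x n)) \<le> b"
    by (intro cSUP_least) auto
  then show ?thesis
    using 1 l1_le_tendsto_0[OF x] by (simp add: seq_space_def seq_norm_def)
next
  case (2 r)
  have b: "0 \<le> b" by (rule l1_le_nonneg[OF x])
  have fin: "(\<Sum>n\<in>F. cmod (x n) powr r) \<le> b powr r" if F: "finite F" for F
  proof -
    have "(\<Sum>n\<in>F. cmod (x n) powr r) \<le> (\<Sum>n\<in>F. cmod (x n) * b powr (r - 1))"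
    proof (rule sum_mono)
      fix n
      have "cmod (x n) \<le> b"
        using x[unfolded l1_le_def, rule_format, of "{n}"] by simp
      then have "cmod (x n) * cmod (x n) powr (r - 1) \<le> cmod (x n) * b powr (r - 1)"
        using 2 by (intro mult_left_mono powr_mono2) auto
      then show "cmod (x n) powr r \<le> cmod (x n) * b powr (r - 1)"
        by (simp add: powr_mult_base)
    qed
    also have "\<dots> \<le> b * b powr (r - 1)"
      using x F by (auto simp: l1_le_def simp flip: sum_distrib_right intro: mult_right_mono)
    also have "\<dots> = b powr r"
      using powr_mult_base[OF b, of "r - 1"] by simp
    finally show ?thesis .
  qed
  have s: "(\<lambda>n. cmod (x n) powr r) summable_on UNIV"
    by (rule nonneg_bdd_above_summable_on) (auto intro!: bdd_aboveI2 fin)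
  have "(\<Sum>\<^sub>\<infinity>n. cmod (x n) powr r) powr (1 / r) \<le> (b powr r) powr (1 / r)"
    using 2 by (intro powr_mono2 infsum_nonneg infsum_le_finite_sums[OF s] fin) auto
  also have "\<dots> = b"
    using 2 b by (simp add: powr_powr)
  finally show ?thesis
    using 2 s by (simp add: seq_space_def seq_norm_def)
qed

text \<open>
  A triangle inequality up to a constant, which suffices for density arguments and follows
  from \<open>\<bar>a + b\<bar>\<^sup>r \<le> 2\<^sup>r (\<bar>a\<bar>\<^sup>r + \<bar>b\<bar>\<^sup>r)\<close>.
\<close>

lemma seq_norm_add_le:
  assumes p: "1 \<le> p" and xy: "x \<in> seq_space p" "y \<in> seq_space p"
    and le: "seq_norm p x \<le> \<delta>" "seq_norm p y \<le> \<delta>"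
  shows "seq_norm p (x + y) \<le> 4 * \<delta>"
  using p
proof (cases rule: exponent_cases)
  case 1
  have "cmod ((x + y) n) \<le> 4 * \<delta>" for n
    using norm_triangle_ineq[of "x n" "y n"] norm_coordinate_le[OF p xy(1), of n]
      norm_coordinate_le[OF p xy(2), of n] le norm_ge_zero[of "x n"]
    unfolding plus_fun_def by linarith
  with 1 show ?thesis
    by (auto simp: seq_norm_def intro!: cSUP_least)
next
  case (2 r)
  have \<delta>: "0 \<le> \<delta>"
    using norm_coordinate_le[OF p xy(1), of 0] le norm_ge_zero[of "x 0"] by linarith
  have s: "(\<lambda>n. cmod (z n) powr r) summable_on UNIV" if "z \<in> seq_space p" for z
    using that 2 by (simp add: seq_space_def)
  have b: "(\<Sum>\<^sub>\<infinity>n. cmod (z n) powr r) \<le> \<delta> powr r" if "seq_norm p z \<le> \<delta>" for z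
  proof -
    have "((\<Sum>\<^sub>\<infinity>n. cmod (z n) powr r) powr (1 / r)) powr r \<le> \<delta> powr r"
      using that 2 by (intro powr_mono2) (auto simp: seq_norm_def)
    then show ?thesis
      using 2 by (simp add: powr_powr infsum_nonneg)
  qed
  have pt: "cmod ((x + y) n) powr r \<le> 2 powr r * (cmod (x n) powr r + cmod (y n) powr r)" for n
  proof -
    have "cmod (x n + y n) powr r \<le> (2 * max (cmod (x n)) (cmod (y n))) powr r"
      using 2 norm_triangle_ineq[of "x n" "y n"] by (intro powr_mono2) (auto simp: max_def)
    also have "\<dots> \<le> 2 powr r * (cmod (x n) powr r + cmod (y n) powr r)"
      by (auto simp: powr_mult max_def)
    finally show ?thesis by simp
  qed
  have "(\<Sum>\<^sub>\<infinity>n. cmod ((x + y) n) powr r)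
      \<le> (\<Sum>\<^sub>\<infinity>n. 2 powr r * (cmod (x n) powr r + cmod (y n) powr r))"
    by (intro infsum_mono s seq_space_add[OF p] xy summable_on_cmult_right summable_on_add pt)
  also have "\<dots> = 2 powr r * ((\<Sum>\<^sub>\<infinity>n. cmod (x n) powr r) + (\<Sum>\<^sub>\<infinity>n. cmod (y n) powr r))"
    by (simp add: infsum_cmult_right' infsum_add s xy)
  also have "\<dots> \<le> 2 powr r * (\<delta> powr r + \<delta> powr r)"
    by (intro mult_left_mono add_mono b le) auto
  also have "\<dots> = 2 powr r * (2 powr 1 * \<delta> powr r)"
    by simp
  also have "\<dots> \<le> 2 powr r * (2 powr r * \<delta> powr r)"
    using 2 by (intro mult_left_mono mult_right_mono powr_mono) auto
  also have "\<dots> = (2 * 2 * \<delta>) powr r"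
    using \<delta> by (simp only: powr_mult mult.assoc)
  finally have "(\<Sum>\<^sub>\<infinity>n. cmod ((x + y) n) powr r) \<le> (4 * \<delta>) powr r"
    by simp
  then have "(\<Sum>\<^sub>\<infinity>n. cmod ((x + y) n) powr r) powr (1 / r) \<le> ((4 * \<delta>) powr r) powr (1 / r)"
    using 2 by (intro powr_mono2 infsum_nonneg) auto
  then show ?thesis
    using 2 \<delta> by (simp add: seq_norm_def powr_powr)
qed


section \<open>Invariant subspaces closed in the summable norm\<close>

definition l1_closure :: "(int \<Rightarrow> complex) set \<Rightarrow> (int \<Rightarrow> complex) set"
  where "l1_closure A = {y. \<forall>\<epsilon>>0. \<exists>z\<in>A. l1_le (y - z) \<epsilon>}"

lemma subset_l1_closure: "A \<subseteq> l1_closure A"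
proof
  fix y assume "y \<in> A"
  then show "y \<in> l1_closure A"
    unfolding l1_closure_def by (auto intro!: bexI[of _ y] l1_le_zero)
qed

lemma l1_closure_closed:
  assumes "\<And>\<epsilon>. 0 < \<epsilon> \<Longrightarrow> \<exists>z\<in>l1_closure A. l1_le (y - z) \<epsilon>"
  shows "y \<in> l1_closure A"
  unfolding l1_closure_def
proof (intro CollectI allI impI)
  fix \<epsilon> :: real assume "0 < \<epsilon>"
  then obtain z where z: "z \<in> l1_closure A" "l1_le (y - z) (\<epsilon> / 2)"
    using assms[of "\<epsilon> / 2"] by auto
  obtain u where u: "u \<in> A" "l1_le (z - u) (\<epsilon> / 2)"
    using z(1) \<open>0 < \<epsilon>\<close> half_gt_zero unfolding l1_closure_def by blast
  have "l1_le (y - u) \<epsilon>"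
    using l1_le_add[OF z(2) u(2)] by simp
  with u(1) show "\<exists>z\<in>A. l1_le (y - z) \<epsilon>" by blast
qed

lemma l1_closure_add:
  assumes A: "module.subspace cscale A" and x: "x \<in> l1_closure A" and y: "y \<in> l1_closure A"
  shows "x + y \<in> l1_closure A"
  unfolding l1_closure_def
proof (intro CollectI allI impI)
  interpret vector_space cscale by (rule vector_space_cscale)
  fix \<epsilon> :: real assume "0 < \<epsilon>"
  then have h: "0 < \<epsilon> / 2" by simp
  obtain u where u: "u \<in> A" "l1_le (x - u) (\<epsilon> / 2)"
    using x h unfolding l1_closure_def by blast
  obtain v where v: "v \<in> A" "l1_le (y - v) (\<epsilon> / 2)"
    using y h unfolding l1_closure_def by blast
  have "l1_le (x + y - (u + v)) \<epsilon>"
    using l1_le_add[OF u(2) v(2)] by (simp add: algebra_simps)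
  with subspace_add[OF A u(1) v(1)] show "\<exists>z\<in>A. l1_le (x + y - z) \<epsilon>" by blast
qed

lemma l1_closure_cscale:
  assumes A: "module.subspace cscale A" and x: "x \<in> l1_closure A"
  shows "cscale c x \<in> l1_closure A"
  unfolding l1_closure_def
proof (intro CollectI allI impI)
  interpret vector_space cscale by (rule vector_space_cscale)
  fix \<epsilon> :: real assume e: "0 < \<epsilon>"
  then have "0 < \<epsilon> / (cmod c + 1)"
    by (intro divide_pos_pos add_nonneg_pos) auto
  then obtain u where u: "u \<in> A" "l1_le (x - u) (\<epsilon> / (cmod c + 1))"
    using x unfolding l1_closure_def by blast
  have "cmod c + 1 > 0" by (intro add_nonneg_pos) auto
  then have "cmod c * (\<epsilon> / (cmod c + 1)) \<le> \<epsilon>"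
    using e by (simp add: field_simps)
  then have "l1_le (cscale c x - cscale c u) \<epsilon>"
    using l1_le_mono[OF l1_le_cscale[OF u(2), of c]] by (simp add: scale_right_diff_distrib)
  with subspace_scale[OF A u(1), of c] show "\<exists>z\<in>A. l1_le (cscale c x - z) \<epsilon>" by blast
qed

lemma weighted_shift_add: "weighted_shift w (x + y) = weighted_shift w x + weighted_shift w y"
  and weighted_shift_diff: "weighted_shift w (x - y) = weighted_shift w x - weighted_shift w y"
  and weighted_shift_cscale: "weighted_shift w (cscale c x) = cscale c (weighted_shift w x)"
  by (auto simp: weighted_shift_def cscale_def fun_eq_iff algebra_simps)

lemma l1_closure_weighted_shift:
  assumes w: "bounded (range w)"
    and A: "weighted_shift w ` A \<subseteq> A" and x: "x \<in> l1_closure A"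
  shows "weighted_shift w x \<in> l1_closure A"
  unfolding l1_closure_def
proof (intro CollectI allI impI)
  obtain C where C: "\<And>n. cmod (w n) \<le> C" "0 < C"
    using w by (auto simp: bounded_pos)
  fix \<epsilon> :: real assume "0 < \<epsilon>"
  then have "0 < \<epsilon> / C" using C by simp
  then obtain u where u: "u \<in> A" "l1_le (x - u) (\<epsilon> / C)"
    using x unfolding l1_closure_def by blast
  have "l1_le (weighted_shift w x - weighted_shift w u) \<epsilon>"
    using l1_le_weighted_shift[OF u(2), of w C] C by (simp add: weighted_shift_diff)
  with u(1) A show "\<exists>z\<in>A. l1_le (weighted_shift w x - z) \<epsilon>" by blast
qed

lemma weighted_shift_image_span_orbit:
  "weighted_shift w ` module.span cscale (range (\<lambda>n. (weighted_shift w ^^ n) x))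
    \<subseteq> module.span cscale (range (\<lambda>n. (weighted_shift w ^^ n) x))"
proof -
  interpret vector_space cscale by (rule vector_space_cscale)
  let ?T = "weighted_shift w" and ?O = "range (\<lambda>n. (weighted_shift w ^^ n) x)"
  have "?T z \<in> span ?O" if "z \<in> span ?O" for z
    using that
  proof (induction rule: span_induct_alt)
    case base
    have "?T 0 = 0" by (simp add: weighted_shift_def fun_eq_iff)
    then show ?case using span_zero by metis
  next
    case (step c u v)
    then obtain n where "u = (?T ^^ n) x" by auto
    then have "?T u = (?T ^^ Suc n) x" by simp
    then have "?T u \<in> span ?O" by (metis rangeI span_base)
    moreover have "?T (cscale c u + v) = cscale c (?T u) + ?T v"
      by (simp only: weighted_shift_add weighted_shift_cscale)
    ultimately show ?case
      using step.IH by (metis span_add span_scale)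
  qed
  then show ?thesis by blast
qed

text \<open>
  The telescoping identity \<open>T\<^sup>n - \<mu>\<^sup>n = (T\<^sup>n\<^sup>-\<^sup>1 + \<mu> T\<^sup>n\<^sup>-\<^sup>2 + \<dots> + \<mu>\<^sup>n\<^sup>-\<^sup>1) (T - \<mu>)\<close> puts
  \<open>T\<^sup>n y - \<mu>\<^sup>n y\<close> into the closure, and \<open>y\<close> differs from a multiple of this vector by
  \<open>\<mu>\<^sup>-\<^sup>n T\<^sup>n y\<close> only.
\<close>

lemma l1_closure_cancel_factor:
  assumes w: "bounded (range w)"
    and A: "module.subspace cscale A" "weighted_shift w ` A \<subseteq> A"
    and mem: "weighted_shift w y - cscale \<mu> y \<in> l1_closure A"
    and "\<mu> \<noteq> 0"
    and small: "\<And>\<epsilon>. 0 < \<epsilon> \<Longrightarrow> \<exists>n. l1_le ((weighted_shift w ^^ n) y) (\<epsilon> * cmod \<mu> ^ n)"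
  shows "y \<in> l1_closure A"
proof (rule l1_closure_closed)
  let ?T = "weighted_shift w"
  note add = l1_closure_add[OF A(1)] and scale = l1_closure_cscale[OF A(1)]
  have geom: "(?T ^^ n) y - cscale (\<mu> ^ n) y \<in> l1_closure A" for n
  proof (induction n)
    case 0
    have "(?T ^^ 0) y - cscale (\<mu> ^ 0) y = cscale 0 (?T y - cscale \<mu> y)"
      by (simp add: cscale_def fun_eq_iff)
    with scale[OF mem] show ?case by metis
  next
    case (Suc n)
    have "(?T ^^ Suc n) y - cscale (\<mu> ^ Suc n) y
        = ?T ((?T ^^ n) y - cscale (\<mu> ^ n) y) + cscale (\<mu> ^ n) (?T y - cscale \<mu> y)"
      by (simp add: weighted_shift_diff weighted_shift_cscale)
        (simp add: cscale_def fun_eq_iff algebra_simps)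
    with add[OF l1_closure_weighted_shift[OF w A(2) Suc] scale[OF mem]] show ?case by metis
  qed
  fix \<epsilon> :: real assume "0 < \<epsilon>"
  then obtain n where n: "l1_le ((?T ^^ n) y) (\<epsilon> * cmod \<mu> ^ n)"
    using small by blast
  have "y - cscale (- inverse (\<mu> ^ n)) ((?T ^^ n) y - cscale (\<mu> ^ n) y)
      = cscale (inverse (\<mu> ^ n)) ((?T ^^ n) y)"
    using \<open>\<mu> \<noteq> 0\<close> by (simp add: cscale_def fun_eq_iff field_simps)
  moreover have "l1_le (cscale (inverse (\<mu> ^ n)) ((?T ^^ n) y)) \<epsilon>"
    using l1_le_cscale[OF n, of "inverse (\<mu> ^ n)"] \<open>\<mu> \<noteq> 0\<close>
    by (simp add: norm_inverse norm_power mult.left_commute)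
  ultimately show "\<exists>z\<in>l1_closure A. l1_le (y - z) \<epsilon>"
    using scale[OF geom] by metis
qed


section \<open>Coefficients of the tails of an infinite product\<close>

text \<open>
  The coefficient of \<open>u\<^sup>l\<close> in \<open>\<Prod>\<^sub>s\<^sub>\<ge>\<^sub>K (1 + \<mu>\<^sub>s u)\<close>, the \<open>l\<close>-th elementary symmetric function of
  \<open>\<mu>\<^sub>K, \<mu>\<^sub>K\<^sub>+\<^sub>1, \<dots>\<close>.  The recursion sorts the monomials by their smallest index \<open>K + s\<close>, so no
  convergence theory for infinite products is involved.
\<close>

fun tail_esym :: "(nat \<Rightarrow> real) \<Rightarrow> nat \<Rightarrow> nat \<Rightarrow> real"
  where
    "tail_esym \<mu> 0 K = 1"
  | "tail_esym \<mu> (Suc l) K = (\<Sum>s. \<mu> (K + s) * tail_esym \<mu> l (Suc (K + s)))"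

lemma halving_le:
  fixes \<mu> :: "nat \<Rightarrow> real"
  assumes "\<And>n. \<mu> (Suc n) \<le> \<mu> n / 2"
  shows "\<mu> (K + s) \<le> \<mu> K * (1 / 2) ^ s"
proof (induction s)
  case (Suc s)
  then show ?case using assms[of "K + s"] by simp
qed simp

text \<open>
  The leading monomial \<open>\<mu>\<^sub>K \<mu>\<^sub>K\<^sub>+\<^sub>1 \<dots> \<mu>\<^sub>K\<^sub>+\<^sub>l\<^sub>-\<^sub>1\<close> dominates: since the rates are at least halved in each
  step, every one of the \<open>l\<close> nested sums is at most twice its first term.  The summability
  statement belongs to the next step of the recursion and is needed for splitting off the
  first term.
\<close>

lemma tail_esym_bounds:
  assumes pos: "\<And>n. 0 < \<mu> n" and half: "\<And>n. \<mu> (Suc n) \<le> \<mu> n / 2"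
  shows "0 \<le> tail_esym \<mu> l K \<and> tail_esym \<mu> l K \<le> (\<Prod>i<l. 2 * \<mu> (K + i))
    \<and> summable (\<lambda>s. \<mu> (K + s) * tail_esym \<mu> l (Suc (K + s)))"
proof -
  have dec: "\<mu> (a + s) \<le> \<mu> a" for a s
    using halving_le[of \<mu> a s, OF half] pos[of a] power_le_one[of "1 / 2 :: real" s]
      mult_left_le[of "(1 / 2 :: real) ^ s" "\<mu> a"] by linarith
  have step: "summable (\<lambda>s. \<mu> (K + s) * tail_esym \<mu> l (Suc (K + s)))
      \<and> (\<forall>s. 0 \<le> \<mu> (K + s) * tail_esym \<mu> l (Suc (K + s)))
      \<and> (\<Sum>s. \<mu> (K + s) * tail_esym \<mu> l (Suc (K + s))) \<le> (\<Prod>i<Suc l. 2 * \<mu> (K + i))"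
    if IH: "\<And>K. 0 \<le> tail_esym \<mu> l K \<and> tail_esym \<mu> l K \<le> (\<Prod>i<l. 2 * \<mu> (K + i))" for l K
  proof -
    let ?f = "\<lambda>s. \<mu> (K + s) * tail_esym \<mu> l (Suc (K + s))"
    let ?c = "\<mu> K * (\<Prod>i<l. 2 * \<mu> (Suc K + i))"
    have nn: "0 \<le> ?f s" for s
      using IH pos[of "K + s"] by simp
    have le: "?f s \<le> ?c * (1 / 2) ^ s" for s
    proof -
      have "tail_esym \<mu> l (Suc (K + s)) \<le> (\<Prod>i<l. 2 * \<mu> (Suc (K + s) + i))"
        using IH by blast
      also have "\<dots> \<le> (\<Prod>i<l. 2 * \<mu> (Suc K + i))"
        using dec[of "Suc K + _" s] pos
        by (intro prod_mono) (auto simp: algebra_simps less_imp_le)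
      finally have "?f s \<le> (\<mu> K * (1 / 2) ^ s) * (\<Prod>i<l. 2 * \<mu> (Suc K + i))"
        using IH pos by (intro mult_mono halving_le[of \<mu>, OF half]) (auto simp: less_imp_le)
      then show ?thesis by (simp add: mult_ac)
    qed
    have geo: "(\<lambda>s. ?c * (1 / 2) ^ s) sums (?c * 2)"
      using sums_mult[OF geometric_sums[of "1 / 2 :: real"], of ?c] by simp
    have sm: "summable ?f"
      by (rule summable_comparison_test'[OF sums_summable[OF geo], of 0]) (use nn le in auto)
    have "suminf ?f \<le> ?c * 2"
      using suminf_le[OF le sm sums_summable[OF geo]] sums_unique[OF geo] by simp
    also have "?c * 2 = (\<Prod>i<Suc l. 2 * \<mu> (K + i))"
      by (simp add: prod.lessThan_Suc_shift del: prod.lessThan_Suc)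
    finally show ?thesis using sm nn by blast
  qed
  have b: "0 \<le> tail_esym \<mu> l K \<and> tail_esym \<mu> l K \<le> (\<Prod>i<l. 2 * \<mu> (K + i))" for l K
  proof (induction l arbitrary: K)
    case (Suc l)
    have "0 \<le> (\<Sum>s. \<mu> (K + s) * tail_esym \<mu> l (Suc (K + s)))"
      using step[OF Suc, of K] by (intro suminf_nonneg) auto
    then show ?case using step[OF Suc, of K] by simp
  qed simp
  show ?thesis using b[of l K] step[of l K, OF b] by blast
qed

text \<open>
  The coefficient form of \<open>\<Prod>\<^sub>s\<^sub>\<ge>\<^sub>K (1 + \<mu>\<^sub>s u) = (1 + \<mu>\<^sub>K u) \<Prod>\<^sub>s\<^sub>>\<^sub>K (1 + \<mu>\<^sub>s u)\<close>.
\<close>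

lemma tail_esym_split:
  assumes pos: "\<And>n. 0 < \<mu> n" and half: "\<And>n. \<mu> (Suc n) \<le> \<mu> n / 2"
  shows "tail_esym \<mu> (Suc l) K = \<mu> K * tail_esym \<mu> l (Suc K) + tail_esym \<mu> (Suc l) (Suc K)"
proof -
  have "summable (\<lambda>s. \<mu> (K + s) * tail_esym \<mu> l (Suc (K + s)))"
    using tail_esym_bounds[of \<mu>, OF pos half] by blast
  from suminf_split_head[OF this] show ?thesis by simp
qed


section \<open>The cyclic vector\<close>

text \<open>
  The factors \<open>\<rho>\<^sub>n\<close> for which \<open>T\<close> maps \<open>\<rho>\<^sub>n e\<^sub>n\<close> to \<open>\<rho>\<^sub>n\<^sub>-\<^sub>1 e\<^sub>n\<^sub>-\<^sub>1\<close>, normalised by \<open>\<rho>\<^sub>0 = 1\<close>.  Thus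
  \<open>\<rho>\<^sub>-\<^sub>m e\<^sub>-\<^sub>m = T\<^sup>m e\<^sub>0\<close> and \<open>\<rho>\<^sub>m e\<^sub>m = S\<^sup>m e\<^sub>0\<close> for \<open>m \<ge> 0\<close>.  For every \<open>n\<close> at least one of the two
  products is empty.
\<close>

definition orbit_weight :: "(int \<Rightarrow> complex) \<Rightarrow> int \<Rightarrow> complex"
  where "orbit_weight w n = (\<Prod>j\<in>{n + 1..0}. w j) / (\<Prod>j\<in>{1..n}. w j)"

lemma orbit_weight_step:
  assumes nz: "\<And>n. w n \<noteq> 0"
  shows "w (n + 1) * orbit_weight w (n + 1) = orbit_weight w n"
proof (cases "0 \<le> n")
  case True
  have "{1..n + 1} = insert (n + 1) {1..n}" using True by auto
  then show ?thesis
    using True nz by (simp add: orbit_weight_def)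
next
  case False
  have "{n + 1..0} = insert (n + 1) {n + 2..0}" using False by auto
  then show ?thesis
    using False by (simp add: orbit_weight_def add.assoc)
qed

lemma orbit_weight_nonzero:
  assumes "\<And>n. w n \<noteq> 0"
  shows "orbit_weight w n \<noteq> 0"
  using assms by (simp add: orbit_weight_def)

lemma cmod_orbit_weight_neg: "cmod (orbit_weight w (- int m)) = wtilde w (1 - int m) 0"
  by (simp add: orbit_weight_def wtilde_def prod_norm)

lemma orbit_weight_growth:
  assumes nz: "\<And>n. w n \<noteq> 0" and C: "\<And>n. cmod (w n) \<le> C"
  shows "cmod (orbit_weight w (n - int i)) \<le> C ^ i * cmod (orbit_weight w n)"
proof (induction i)
  case (Suc i)
  have "0 \<le> C" using C[of 0] norm_ge_zero[of "w 0"] by linarith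
  have "orbit_weight w (n - int (Suc i)) = w (n - int i) * orbit_weight w (n - int i)"
    using orbit_weight_step[of w "n - int (Suc i)", OF nz] by (simp add: algebra_simps)
  then have "cmod (orbit_weight w (n - int (Suc i))) \<le> C * (C ^ i * cmod (orbit_weight w n))"
    using C Suc \<open>0 \<le> C\<close> by (auto simp: norm_mult intro!: mult_mono)
  then show ?case by (simp add: mult_ac)
qed simp

text \<open>
  The lower limit makes \<open>\<parallel>T\<^sup>m e\<^sub>0\<parallel>\<^sup>1\<^sup>/\<^sup>m\<close> smaller than \<open>1 / (2 Q)\<close> for arbitrarily large \<open>m\<close>,
  whence \<open>Q\<^sup>m \<parallel>T\<^sup>m e\<^sub>0\<parallel> \<le> 2\<^sup>-\<^sup>m\<close>.
\<close>

lemma orbit_weight_superexponential: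
  assumes "liminf (\<lambda>n::nat. ereal (wtilde w (1 - int n) 0 powr (1 / real n))) = 0"
    and "0 < Q" and "0 < \<epsilon>"
  shows "\<exists>m\<ge>N. Q ^ m * cmod (orbit_weight w (- int m)) < \<epsilon>"
proof -
  let ?f = "\<lambda>n::nat. wtilde w (1 - int n) 0 powr (1 / real n)"
  \<comment> \<open>The 2 leaves room for a factor that tends to 0 and falls below any \<open>\<epsilon>\<close>.\<close>
  define \<delta> where "\<delta> = 1 / (2 * Q)"
  have "0 < \<delta>" using \<open>0 < Q\<close> by (simp add: \<delta>_def)
  have "(\<lambda>n. (1 / 2 :: real) ^ n) \<longlonglongrightarrow> 0"
    by (rule LIMSEQ_power_zero) simp
  then have "\<forall>\<^sub>F n in sequentially. (1 / 2 :: real) ^ n < \<epsilon>"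
    using \<open>0 < \<epsilon>\<close> by (rule order_tendstoD)
  then obtain N' where N': "\<And>n. n \<ge> N' \<Longrightarrow> (1 / 2 :: real) ^ n < \<epsilon>"
    by (auto simp: eventually_sequentially)
  have "\<exists>m \<ge> max (Suc N) N'. ?f m < \<delta>"
  proof (rule ccontr)
    assume "\<not> ?thesis"
    then have "\<forall>\<^sub>F n in sequentially. ereal \<delta> \<le> ereal (?f n)"
      unfolding eventually_sequentially by (intro exI[of _ "max (Suc N) N'"]) (auto simp: not_less)
    then have "ereal \<delta> \<le> liminf (\<lambda>n. ereal (?f n))"
      by (rule Liminf_bounded)
    with assms(1) \<open>0 < \<delta>\<close> show False by simp
  qed
  then obtain m where m: "Suc N \<le> m" "N' \<le> m" "?f m < \<delta>" by auto
  have wt: "0 \<le> wtilde w (1 - int m) 0"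
    by (simp add: wtilde_def prod_nonneg)
  have "wtilde w (1 - int m) 0 = ?f m ^ m"
    using m(1) wt by (cases "wtilde w (1 - int m) 0 = 0") (simp_all add: powr_power)
  also have "\<dots> \<le> \<delta> ^ m"
    using m by (intro power_mono) auto
  finally have "Q ^ m * wtilde w (1 - int m) 0 \<le> Q ^ m * \<delta> ^ m"
    using \<open>0 < Q\<close> by (intro mult_left_mono) auto
  also have "\<dots> = (1 / 2) ^ m"
    using \<open>0 < Q\<close> by (simp add: \<delta>_def flip: power_mult_distrib)
  also have "\<dots> < \<epsilon>" by (rule N'[OF m(2)])
  finally show ?thesis
    using m(1) by (intro exI[of _ m]) (simp add: cmod_orbit_weight_neg)
qed

definition weight_majorant :: "(int \<Rightarrow> complex) \<Rightarrow> nat \<Rightarrow> real"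
  where "weight_majorant w n = 1 + (\<Sum>j\<in>{- int n..int n}. cmod (orbit_weight w j))"

lemma weight_majorant_ge_1: "1 \<le> weight_majorant w n"
  by (simp add: weight_majorant_def sum_nonneg)

lemma weight_majorant_mono: "m \<le> n \<Longrightarrow> weight_majorant w m \<le> weight_majorant w n"
  by (auto simp: weight_majorant_def intro!: sum_mono2)

lemma orbit_weight_le_majorant:
  assumes "\<bar>j\<bar> \<le> int n"
  shows "cmod (orbit_weight w j) \<le> weight_majorant w n"
proof -
  have "cmod (orbit_weight w j) \<le> (\<Sum>j\<in>{- int n..int n}. cmod (orbit_weight w j))"
    using assms by (intro member_le_sum) auto
  then show ?thesis by (simp add: weight_majorant_def)
qed

text \<open>
  The rates \<open>\<mu>\<^sub>n\<close> of the product.  The majorant makes the coefficients beat the orbit weights,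
  which may grow at any speed; \<open>2\<^sup>n\<close> gives the halving property and lets the tails converge
  to \<open>e\<^sub>0\<close>; the factor \<open>n + 1\<close> turns into a factorial in the coefficients.
\<close>

definition product_rate :: "(int \<Rightarrow> complex) \<Rightarrow> nat \<Rightarrow> real"
  where "product_rate w n = 1 / (2 * (weight_majorant w (Suc n) * 2 ^ n * real (Suc n)))"

lemma product_rate_pos: "0 < product_rate w n"
  using weight_majorant_ge_1[of w "Suc n"] by (simp add: product_rate_def)

lemma product_rate_halving: "product_rate w (Suc n) \<le> product_rate w n / 2"
proof -
  have "weight_majorant w (Suc n) * 2 ^ n * real (Suc n)
      \<le> weight_majorant w (Suc (Suc n)) * 2 ^ n * real (Suc (Suc n))"
    using weight_majorant_ge_1[of w "Suc (Suc n)"]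
    by (intro mult_mono weight_majorant_mono) auto
  then have "1 / (4 * (weight_majorant w (Suc (Suc n)) * 2 ^ n * real (Suc (Suc n))))
      \<le> 1 / (4 * (weight_majorant w (Suc n) * 2 ^ n * real (Suc n)))"
    using weight_majorant_ge_1[of w "Suc n"] weight_majorant_ge_1[of w "Suc (Suc n)"]
    by (intro divide_left_mono mult_left_mono mult_pos_pos) auto
  then show ?thesis by (simp add: product_rate_def mult_ac)
qed

text \<open>
  The last of the \<open>l\<close> factors contributes both the majorant and \<open>2\<^sup>-\<^sup>K\<close>; from each of the
  others only \<open>1 / (i + 1)\<close> is kept.
\<close>

lemma prod_rate_le:
  assumes "0 < l"
  shows "(\<Prod>i<l. 2 * product_rate w (K + i)) \<le> (1 / 2) ^ K / (fact l * weight_majorant w (K + l))"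
proof -
  have le: "2 * product_rate w (K + i) \<le> (1 / 2) ^ K / real (Suc i)" for i
  proof -
    have "2 ^ K * real (Suc i) \<le> weight_majorant w (Suc (K + i)) * 2 ^ (K + i) * real (Suc (K + i))"
    proof -
      have "1 * 2 ^ K \<le> weight_majorant w (Suc (K + i)) * 2 ^ (K + i)"
        using weight_majorant_ge_1[of w "Suc (K + i)"] by (intro mult_mono) auto
      then show ?thesis
        using weight_majorant_ge_1[of w "Suc (K + i)"] by (intro mult_mono) auto
    qed
    then have "1 / (weight_majorant w (Suc (K + i)) * 2 ^ (K + i) * real (Suc (K + i)))
        \<le> 1 / (2 ^ K * real (Suc i))"
      using weight_majorant_ge_1[of w "Suc (K + i)"]
      by (intro divide_left_mono mult_pos_pos) auto
    then show ?thesis by (simp add: product_rate_def power_one_over)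
  qed
  have le1: "2 * product_rate w (K + i) \<le> 1 / real (Suc i)" for i
  proof -
    have "(1 / 2 :: real) ^ K / real (Suc i) \<le> 1 / real (Suc i)"
      by (intro divide_right_mono power_le_one) auto
    with le[of i] show ?thesis by linarith
  qed
  obtain l' where l': "l = Suc l'" using assms by (cases l) auto
  have last: "2 * product_rate w (K + l') \<le> (1 / 2) ^ K / (real (Suc l') * weight_majorant w (K + l))"
  proof -
    have "2 ^ K * (real (Suc l') * weight_majorant w (K + l))
        \<le> 2 ^ (K + l') * (real (Suc (K + l')) * weight_majorant w (K + l))"
      using weight_majorant_ge_1[of w "K + l"] by (intro mult_mono) auto
    then have "1 / (2 ^ (K + l') * (real (Suc (K + l')) * weight_majorant w (K + l)))
      \<le> 1 / (2 ^ K * (real (Suc l') * weight_majorant w (K + l)))"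
      using weight_majorant_ge_1[of w "K + l"]
      by (intro divide_left_mono mult_pos_pos) auto
    then show ?thesis by (simp add: product_rate_def power_one_over l' mult_ac)
  qed
  have "(\<Prod>i<l'. 2 * product_rate w (K + i)) \<le> (\<Prod>i<l'. 1 / real (Suc i))"
    using le1 product_rate_pos[of w] by (intro prod_mono) (auto simp: less_imp_le)
  also have "\<dots> = 1 / fact l'"
    by (simp add: fact_prod_Suc prod_dividef atLeast0LessThan)
  finally have "(\<Prod>i<l. 2 * product_rate w (K + i))
      \<le> (1 / fact l') * ((1 / 2) ^ K / (real (Suc l') * weight_majorant w (K + l)))"
    unfolding l' prod.lessThan_Suc using last product_rate_pos[of w "K + l'"]
    by (intro mult_mono) (auto simp: l' less_imp_le)
  then show ?thesis by (simp add: l' mult_ac)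
qed

definition tail_coeff :: "(int \<Rightarrow> complex) \<Rightarrow> nat \<Rightarrow> nat \<Rightarrow> real"
  where "tail_coeff w = tail_esym (product_rate w)"

lemma tail_coeff_0: "tail_coeff w 0 K = 1"
  by (simp add: tail_coeff_def)

lemma tail_coeff_Suc:
  "tail_coeff w (Suc l) K = product_rate w K * tail_coeff w l (Suc K) + tail_coeff w (Suc l) (Suc K)"
  unfolding tail_coeff_def by (rule tail_esym_split[of "product_rate w", OF product_rate_pos product_rate_halving])

lemma tail_coeff_nonneg: "0 \<le> tail_coeff w l K"
  using tail_esym_bounds[of "product_rate w" l K, OF product_rate_pos product_rate_halving]
  by (simp add: tail_coeff_def)

lemma tail_coeff_weight_le:
  assumes "0 < l" "\<bar>j\<bar> \<le> int (K + l)"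
  shows "tail_coeff w l K * cmod (orbit_weight w j) \<le> (1 / 2) ^ K / fact l"
proof -
  let ?V = "weight_majorant w (K + l)"
  have V: "1 \<le> ?V" by (rule weight_majorant_ge_1)
  have "tail_coeff w l K \<le> (1 / 2) ^ K / (fact l * ?V)"
    using tail_esym_bounds[of "product_rate w" l K, OF product_rate_pos product_rate_halving]
      prod_rate_le[OF assms(1), of w K] by (simp add: tail_coeff_def)
  then have "tail_coeff w l K * cmod (orbit_weight w j) \<le> (1 / 2) ^ K / (fact l * ?V) * ?V"
    using orbit_weight_le_majorant[OF assms(2)] V by (intro mult_mono) auto
  also have "\<dots> = (1 / 2) ^ K / fact l"
    using V by simp
  finally show ?thesis .
qed

lemma tail_coeff_le: "tail_coeff w l K \<le> 1 / fact l"
proof (cases "l = 0")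
  case False
  have "orbit_weight w 0 = 1" by (simp add: orbit_weight_def)
  then have "tail_coeff w l K \<le> (1 / 2) ^ K / fact l"
    using tail_coeff_weight_le[of l 0 K w] False by simp
  also have "\<dots> \<le> 1 / fact l"
    by (intro divide_right_mono power_le_one) auto
  finally show ?thesis .
qed (simp add: tail_coeff_0)

text \<open>
  The vector \<open>S\<^sup>k \<Prod>\<^sub>s\<^sub>\<ge>\<^sub>K (1 + \<mu>\<^sub>s S) e\<^sub>0\<close>.  Since \<open>S\<^sup>n e\<^sub>0 = \<rho>\<^sub>n e\<^sub>n\<close>, its coordinate at \<open>k + l\<close> is the
  \<open>l\<close>-th coefficient of the product times \<open>\<rho>\<^sub>k\<^sub>+\<^sub>l\<close>.  The index \<open>k\<close> may be negative, which
  describes the images under powers of \<open>T\<close>.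
\<close>

definition tail_vector :: "(int \<Rightarrow> complex) \<Rightarrow> int \<Rightarrow> nat \<Rightarrow> int \<Rightarrow> complex"
  where "tail_vector w k K =
    (\<lambda>n. if k \<le> n then of_real (tail_coeff w (nat (n - k)) K) * orbit_weight w n else 0)"

lemma weighted_shift_tail_vector:
  assumes "\<And>n. w n \<noteq> 0"
  shows "weighted_shift w (tail_vector w k K) = tail_vector w (k - 1) K"
  using orbit_weight_step[of w, OF assms]
  by (auto simp: weighted_shift_def tail_vector_def fun_eq_iff algebra_simps)

lemma weighted_shift_power_tail_vector:
  assumes "\<And>n. w n \<noteq> 0"
  shows "(weighted_shift w ^^ n) (tail_vector w k K) = tail_vector w (k - int n) K"
  by (induction n) (simp_all add: weighted_shift_tail_vector[OF assms] algebra_simps)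

text \<open>
  This is \<open>x\<^sub>k\<^sub>,\<^sub>K = (1 + \<mu>\<^sub>K S) x\<^sub>k\<^sub>,\<^sub>K\<^sub>+\<^sub>1 = (T + \<mu>\<^sub>K) x\<^sub>k\<^sub>+\<^sub>1\<^sub>,\<^sub>K\<^sub>+\<^sub>1\<close>, written with \<open>- \<mu>\<^sub>K\<close> in the shape
  \<open>T y - \<mu> y\<close> of \<open>l1_closure_cancel_factor\<close>.
\<close>

lemma tail_vector_factor:
  assumes "\<And>n. w n \<noteq> 0"
  shows "tail_vector w k K = weighted_shift w (tail_vector w (k + 1) (Suc K))
    - cscale (- of_real (product_rate w K)) (tail_vector w (k + 1) (Suc K))"
proof
  have shift: "weighted_shift w (tail_vector w (k + 1) (Suc K)) = tail_vector w k (Suc K)"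
    using weighted_shift_tail_vector[of w "k + 1", OF assms] by simp
  fix n
  consider "n < k" | "n = k" | "k < n" by linarith
  then show "tail_vector w k K n = (weighted_shift w (tail_vector w (k + 1) (Suc K))
    - cscale (- of_real (product_rate w K)) (tail_vector w (k + 1) (Suc K))) n"
  proof cases
    case 3
    define l where "l = nat (n - k - 1)"
    have "nat (n - k) = Suc l" "nat (n - (k + 1)) = l"
      using 3 by (auto simp: l_def)
    with 3 show ?thesis
      by (simp add: shift) (simp add: tail_vector_def cscale_def tail_coeff_Suc[of w l K] algebra_simps)
  qed (simp_all add: shift, simp_all add: tail_vector_def cscale_def tail_coeff_0)
qed

lemma summable_inverse_fact: "summable (\<lambda>l. c / fact l :: real)"
  using summable_mult[OF summable_exp[of "1 :: real"], of c] by (simp add: field_simps)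

lemma suminf_inverse_fact: "(\<Sum>l. c / fact l :: real) = c * exp 1"
  using suminf_mult[OF summable_exp[of "1 :: real"], of c]
  by (simp add: exp_def field_simps)

text \<open>
  Only the coefficients with \<open>l \<ge> 1\<close> remain in the difference, and each of them carries a
  factor \<open>2\<^sup>-\<^sup>K\<close>.  So \<open>x\<^sub>k\<^sub>,\<^sub>K\<close> tends to \<open>\<rho>\<^sub>k e\<^sub>k\<close> as \<open>K\<close> grows.
\<close>

lemma tail_vector_l1:
  assumes "\<bar>k\<bar> \<le> int K"
  shows "l1_le (tail_vector w k K - cscale (orbit_weight w k) (unit_seq k)) ((1 / 2) ^ K * exp 1)"
proof -
  have "l1_le (tail_vector w k K - cscale (orbit_weight w k) (unit_seq k))
      (\<Sum>l. (1 / 2) ^ K / fact l)"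
  proof (rule l1_leI_from[OF summable_inverse_fact])
    show "cmod ((tail_vector w k K - cscale (orbit_weight w k) (unit_seq k)) (k + int l))
        \<le> (1 / 2) ^ K / fact l" for l
    proof (cases "l = 0")
      case False
      then have "cmod (tail_vector w k K (k + int l)) \<le> (1 / 2) ^ K / fact l"
        using tail_coeff_weight_le[of l "k + int l" K w] assms
        by (simp add: tail_vector_def norm_mult tail_coeff_nonneg)
      with False show ?thesis by (simp add: cscale_def unit_seq_def)
    qed (simp add: tail_vector_def cscale_def unit_seq_def tail_coeff_0)
  qed (auto simp: tail_vector_def cscale_def unit_seq_def)
  then show ?thesis by (simp add: suminf_inverse_fact)
qed

lemma exp_tail_small:
  fixes R \<epsilon> :: real
  assumes "0 < \<epsilon>"
  shows "\<exists>N. \<forall>m\<ge>N. (\<Sum>l. R ^ (l + m) / fact (l + m)) < \<epsilon>"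
proof -
  have s: "summable (\<lambda>l. R ^ l / fact l)"
    using summable_exp[of R] by (simp add: field_simps)
  from suminf_exist_split[OF assms this] show ?thesis
    by (auto simp: abs_less_iff)
qed

text \<open>
  Let \<open>D\<close> bound the weights and put \<open>R = max 1 (1 / \<mu>)\<close>.  After \<open>k + 2 m\<close> steps the vector has become \<open>x\<^sub>-\<^sub>2\<^sub>m\<^sub>,\<^sub>K = \<Sum>\<^sub>l c\<^sub>l \<rho>\<^sub>l\<^sub>-\<^sub>2\<^sub>m e\<^sub>l\<^sub>-\<^sub>2\<^sub>m\<close> with
  \<open>0 \<le> c\<^sub>l \<le> 1 / l!\<close>.  For \<open>l \<le> m\<close> the weight \<open>\<rho>\<^sub>l\<^sub>-\<^sub>2\<^sub>m\<close> arises from \<open>\<rho>\<^sub>-\<^sub>m\<close> by at most \<open>m\<close> further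
  applications of \<open>T\<close>, so it is at most \<open>D\<^sup>m \<bar>\<rho>\<^sub>-\<^sub>m\<bar>\<close>, superexponentially small for suitable \<open>m\<close>.
  For \<open>l > m\<close> the index satisfies \<open>\<bar>l - 2 m\<bar> \<le> l\<close>, so the choice of the rates bounds
  \<open>c\<^sub>l \<bar>\<rho>\<^sub>l\<^sub>-\<^sub>2\<^sub>m\<bar>\<close> by \<open>1 / l!\<close>, and \<open>R\<^sup>2\<^sup>m \<Sum>\<^sub>l\<^sub>>\<^sub>m 1 / l!\<close> is at most a tail of the series of \<open>exp (R\<^sup>2)\<close>.
\<close>

lemma tail_vector_orbit_small:
  assumes w: "bounded (range w)" and nz: "\<And>n. w n \<noteq> 0"
    and lim: "liminf (\<lambda>n::nat. ereal (wtilde w (1 - int n) 0 powr (1 / real n))) = 0"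
    and "0 < \<mu>" and "0 < \<epsilon>"
  shows "\<exists>n. l1_le ((weighted_shift w ^^ n) (tail_vector w (int k) K)) (\<epsilon> * \<mu> ^ n)"
proof -
  obtain C where C: "\<And>n. cmod (w n) \<le> C" "0 < C"
    using w by (auto simp: bounded_pos)
  define D where "D = max 1 C"
  have D: "1 \<le> D" "\<And>n. cmod (w n) \<le> D"
    using C by (auto simp: D_def max.coboundedI2)
  define R where "R = max 1 (1 / \<mu>)"
  have R: "1 \<le> R" "1 / R \<le> \<mu>"
    using \<open>0 < \<mu>\<close> by (auto simp: R_def max_def field_simps)
  \<comment> \<open>Half of \<open>\<epsilon>\<close> is spent on the terms with \<open>l \<le> m\<close>, whose coefficients sum to at most \<open>exp 1\<close>.\<close>
  define \<eta> where "\<eta> = \<epsilon> / (2 * R ^ k * exp 1)"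
  have \<eta>: "0 < \<eta>" using R \<open>0 < \<epsilon>\<close> by (simp add: \<eta>_def)
  obtain N where N: "\<And>m. N \<le> m \<Longrightarrow> (\<Sum>l. (R^2) ^ (l + m) / fact (l + m)) < \<epsilon> / (2 * R ^ k)"
    using exp_tail_small[of "\<epsilon> / (2 * R ^ k)" "R^2"] \<open>0 < \<epsilon>\<close> R by auto
  obtain m where m: "N \<le> m" "(R^2 * D) ^ m * cmod (orbit_weight w (- int m)) < \<eta>"
    using orbit_weight_superexponential[OF lim _ \<eta>, of "R^2 * D" N] R D by auto
  define a where "a = D ^ m * cmod (orbit_weight w (- int m))"
  have a: "0 \<le> a" using D by (simp add: a_def)
  define h where "h l = (if m \<le> l then (1 / fact l :: real) else 0)" for l
  have sh: "summable h"
    by (rule summable_comparison_test'[OF summable_inverse_fact[of 1], of 0]) (auto simp: h_def)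
  let ?g = "\<lambda>l. a / fact l + h l"
  have sg: "summable ?g"
    by (intro summable_add summable_inverse_fact sh)
  have le: "l1_le (tail_vector w (- 2 * int m) K) (suminf ?g)"
  proof (rule l1_leI_from[OF sg])
    show "0 \<le> ?g l" for l using a by (simp add: h_def)
    show "cmod (tail_vector w (- 2 * int m) K (- 2 * int m + int l)) \<le> ?g l" for l
    proof (cases "l \<le> m")
      case True
      have "cmod (orbit_weight w (- int m - int (m - l))) \<le> D ^ (m - l) * cmod (orbit_weight w (- int m))"
        by (rule orbit_weight_growth[OF nz D(2)])
      also have "\<dots> \<le> a"
        unfolding a_def using D by (intro mult_right_mono power_increasing) auto
      finally have "cmod (orbit_weight w (- 2 * int m + int l)) \<le> a"
        using True by (simp add: of_nat_diff algebra_simps)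
      then have "tail_coeff w l K * cmod (orbit_weight w (- 2 * int m + int l)) \<le> (1 / fact l) * a"
        using a by (intro mult_mono tail_coeff_le) auto
      moreover have "0 \<le> h l" by (simp add: h_def)
      ultimately show ?thesis
        by (simp add: tail_vector_def norm_mult tail_coeff_nonneg)
    next
      case False
      then have "tail_coeff w l K * cmod (orbit_weight w (- 2 * int m + int l)) \<le> (1 / 2) ^ K / fact l"
        by (intro tail_coeff_weight_le) auto
      also have "\<dots> \<le> 1 / fact l"
        by (intro divide_right_mono power_le_one) auto
      finally have "tail_coeff w l K * cmod (orbit_weight w (- 2 * int m + int l)) \<le> 1 / fact l" .
      moreover have "0 \<le> a / fact l" using a by simp
      ultimately show ?thesis
        using False by (simp add: tail_vector_def norm_mult tail_coeff_nonneg h_def)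
    qed
  qed (auto simp: tail_vector_def)
  have "R ^ (k + 2 * m) * suminf ?g \<le> \<epsilon>"
  proof -
    have "suminf ?g = a * exp 1 + suminf h"
      using suminf_add[OF summable_inverse_fact[of a] sh] by (simp add: suminf_inverse_fact)
    moreover have "R ^ (k + 2 * m) * (a * exp 1) \<le> \<epsilon> / 2"
    proof -
      have "R ^ (2 * m) * a \<le> \<eta>"
        using m(2) by (simp add: a_def power_mult_distrib mult_ac flip: power_mult)
      then have "R ^ k * exp 1 * (R ^ (2 * m) * a) \<le> R ^ k * exp 1 * \<eta>"
        using R by (intro mult_left_mono) auto
      also have "\<dots> = \<epsilon> / 2"
        using R by (simp add: \<eta>_def)
      finally show ?thesis by (simp add: power_add mult_ac)
    qed
    moreover have "R ^ (k + 2 * m) * suminf h \<le> \<epsilon> / 2"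
    proof -
      have "suminf h = (\<Sum>l. h (l + m)) + sum h {..<m}"
        by (rule suminf_split_initial_segment[OF sh])
      also have "sum h {..<m} = 0" by (simp add: h_def)
      finally have "R ^ (2 * m) * suminf h = (\<Sum>l. R ^ (2 * m) * h (l + m))"
        using suminf_mult[of "\<lambda>l. h (l + m)" "R ^ (2 * m)"] sh by (simp add: summable_iff_shift)
      also have "\<dots> \<le> (\<Sum>l. (R^2) ^ (l + m) / fact (l + m))"
      proof (rule suminf_le)
        show "R ^ (2 * m) * h (l + m) \<le> (R^2) ^ (l + m) / fact (l + m)" for l
        proof -
          have "(R^2) ^ m \<le> (R^2) ^ (l + m)"
            using R by (intro power_increasing) auto
          then show ?thesis by (simp add: h_def power_mult divide_right_mono)
        qed
        show "summable (\<lambda>l. R ^ (2 * m) * h (l + m))"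
          using sh by (intro summable_mult) (simp add: summable_iff_shift)
        have "summable (\<lambda>l. (R^2) ^ l / fact l)"
          using summable_exp[of "R^2"] by (simp add: field_simps)
        then show "summable (\<lambda>l. (R^2) ^ (l + m) / fact (l + m))"
          by (subst summable_iff_shift)
      qed
      also have "\<dots> \<le> \<epsilon> / (2 * R ^ k)"
        using N[OF m(1)] by simp
      finally have "R ^ k * (R ^ (2 * m) * suminf h) \<le> R ^ k * (\<epsilon> / (2 * R ^ k))"
        using R by (intro mult_left_mono) auto
      also have "\<dots> = \<epsilon> / 2" using R by simp
      finally show ?thesis by (simp add: power_add mult_ac)
    qed
    ultimately show ?thesis by (simp add: distrib_left)
  qed
  then have "suminf ?g \<le> \<epsilon> * (1 / R) ^ (k + 2 * m)"
    using R by (simp add: field_simps power_one_over)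
  also have "\<dots> \<le> \<epsilon> * \<mu> ^ (k + 2 * m)"
    using R \<open>0 < \<epsilon>\<close> by (intro mult_left_mono power_mono) auto
  finally have "l1_le (tail_vector w (- 2 * int m) K) (\<epsilon> * \<mu> ^ (k + 2 * m))"
    by (rule l1_le_mono[OF le])
  then show ?thesis
    by (intro exI[of _ "k + 2 * m"]) (simp add: weighted_shift_power_tail_vector[OF nz])
qed

lemma unit_seq_in_orbit_closure:
  assumes w: "bounded (range w)" and nz: "\<And>n. w n \<noteq> 0"
    and lim: "liminf (\<lambda>n::nat. ereal (wtilde w (1 - int n) 0 powr (1 / real n))) = 0"
  shows "unit_seq k \<in>
    l1_closure (module.span cscale (range (\<lambda>n. (weighted_shift w ^^ n) (tail_vector w 0 0))))"
proof -
  interpret vector_space cscale by (rule vector_space_cscale)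
  define A where "A = span (range (\<lambda>n. (weighted_shift w ^^ n) (tail_vector w 0 0)))"
  have A: "subspace A" "weighted_shift w ` A \<subseteq> A"
    unfolding A_def by (simp_all add: weighted_shift_image_span_orbit)
  \<comment> \<open>Each cancelled factor raises both indices by one, so the induction moves along the diagonal.\<close>
  have diag: "tail_vector w (int K) K \<in> l1_closure A" for K
  proof (induction K)
    case 0
    have "(weighted_shift w ^^ 0) (tail_vector w 0 0) \<in> A"
      unfolding A_def by (intro span_base rangeI)
    with subset_l1_closure show ?case by auto
  next
    case (Suc K)
    show ?case
    proof (rule l1_closure_cancel_factor[OF w A])
      show "weighted_shift w (tail_vector w (int (Suc K)) (Suc K))
          - cscale (- of_real (product_rate w K)) (tail_vector w (int (Suc K)) (Suc K)) \<in> l1_closure A"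
        using tail_vector_factor[of w "int K" K, OF nz] Suc by (metis add.commute of_nat_Suc)
      show "- complex_of_real (product_rate w K) \<noteq> 0"
        using product_rate_pos[of w K] by simp
      show "\<exists>n. l1_le ((weighted_shift w ^^ n) (tail_vector w (int (Suc K)) (Suc K)))
          (\<epsilon> * cmod (- complex_of_real (product_rate w K)) ^ n)" if "0 < \<epsilon>" for \<epsilon>
        using tail_vector_orbit_small[OF w nz lim product_rate_pos[of w K] that, of "Suc K" "Suc K"]
          product_rate_pos[of w K] by simp
    qed
  qed
  have below: "tail_vector w (int K - int n) K \<in> l1_closure A" for K n
  proof (induction n)
    case (Suc n)
    have "tail_vector w (int K - int (Suc n)) K = weighted_shift w (tail_vector w (int K - int n) K)"
      by (simp add: weighted_shift_tail_vector[OF nz] algebra_simps)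
    then show ?case
      using l1_closure_weighted_shift[OF w A(2) Suc] by simp
  qed (simp add: diag)
  have "cscale (orbit_weight w k) (unit_seq k) \<in> l1_closure A"
  proof (rule l1_closure_closed)
    fix \<epsilon> :: real assume "0 < \<epsilon>"
    have "(\<lambda>K. (1 / 2 :: real) ^ K * exp 1) \<longlonglongrightarrow> 0 * exp 1"
      by (intro tendsto_mult_right LIMSEQ_power_zero) simp
    then have "\<forall>\<^sub>F K in sequentially. (1 / 2 :: real) ^ K * exp 1 < \<epsilon>"
      using \<open>0 < \<epsilon>\<close> by (intro order_tendstoD) auto
    then obtain K0 where K0: "\<And>K. K \<ge> K0 \<Longrightarrow> (1 / 2 :: real) ^ K * exp 1 < \<epsilon>"
      by (auto simp: eventually_sequentially)
    define K where "K = max K0 (nat \<bar>k\<bar>)"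
    have K: "\<bar>k\<bar> \<le> int K" "(1 / 2 :: real) ^ K * exp 1 < \<epsilon>"
      using K0[of K] by (auto simp: K_def)
    have "cscale (orbit_weight w k) (unit_seq k) - tail_vector w k K
        = cscale (- 1) (tail_vector w k K - cscale (orbit_weight w k) (unit_seq k))"
      by (simp add: cscale_def fun_eq_iff)
    then have "l1_le (cscale (orbit_weight w k) (unit_seq k) - tail_vector w k K) \<epsilon>"
      using l1_le_cscale[OF tail_vector_l1[OF K(1)], of "- 1" w] K(2) l1_le_mono by fastforce
    moreover have "tail_vector w k K \<in> l1_closure A"
    proof -
      have "int K - int (nat (int K - k)) = k" using K(1) by linarith
      with below[of K "nat (int K - k)"] show ?thesis by metis
    qed
    ultimately show "\<exists>z\<in>l1_closure A. l1_le (cscale (orbit_weight w k) (unit_seq k) - z) \<epsilon>"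
      by blast
  qed
  from l1_closure_cscale[OF A(1) this, of "inverse (orbit_weight w k)"]
  show ?thesis
    using orbit_weight_nonzero[of w k, OF nz] by (simp add: A_def)
qed

theorem corollary1p4:
  fixes w :: "int \<Rightarrow> complex"
  assumes "bounded (range w)"
    and "\<And>n. w n \<noteq> 0"
    and "liminf (\<lambda>n::nat. ereal (wtilde w (1 - int n) 0 powr (1 / real n))) = 0"
  shows "\<forall>p::ereal. 1 \<le> p \<longrightarrow> cyclic_on (seq_space p) (seq_norm p) (weighted_shift w)"
proof (intro allI impI)
  interpret vector_space cscale by (rule vector_space_cscale)
  fix p :: ereal assume p: "1 \<le> p"
  let ?x = "tail_vector w 0 0"
  let ?A = "span (range (\<lambda>n. (weighted_shift w ^^ n) ?x))"
  have fin: "(\<lambda>n. if n \<in> F then y n else 0) \<in> l1_closure ?A" if "finite F" for F y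
    using that
  proof (induction F)
    case empty
    have "(\<lambda>n. if n \<in> {} then y n else 0) = 0" by (simp add: fun_eq_iff)
    then show ?case
      using subset_l1_closure span_zero by (metis (no_types, lifting) subsetD)
  next
    case (insert a F)
    have "(\<lambda>n. if n \<in> insert a F then y n else 0)
        = cscale (y a) (unit_seq a) + (\<lambda>n. if n \<in> F then y n else 0)"
      using insert.hyps by (auto simp: fun_eq_iff cscale_def unit_seq_def)
    then show ?case
      using l1_closure_add[OF subspace_span l1_closure_cscale[OF subspace_span
          unit_seq_in_orbit_closure[OF assms]] insert.IH] by metis
  qed
  have "?x \<in> seq_space p"
  proof -
    have "l1_le (cscale 1 (unit_seq 0)) 1"
      by (auto simp: l1_le_def cscale_def unit_seq_def if_distrib sum.delta cong: if_cong)
    from l1_le_add[OF tail_vector_l1[of 0 0 w] this]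
    show ?thesis
      using l1_le_imp_seq_norm_le[OF _ p] by (simp add: orbit_weight_def)
  qed
  moreover have "\<exists>z\<in>?A. seq_norm p (y - z) < \<epsilon>" if y: "y \<in> seq_space p" and \<epsilon>: "0 < \<epsilon>" for y \<epsilon>
  proof -
    \<comment> \<open>The constant 4 of \<open>seq_norm_add_le\<close> turns \<open>\<epsilon> / 8\<close> into \<open>\<epsilon> / 2 < \<epsilon>\<close>.\<close>
    have \<delta>: "0 < \<epsilon> / 8" using \<epsilon> by simp
    obtain F where F: "finite F"
      and t: "(\<lambda>n. if n \<in> F then 0 else y n) \<in> seq_space p" (is "?t \<in> _")
        "seq_norm p (\<lambda>n. if n \<in> F then 0 else y n) \<le> \<epsilon> / 8"
      using truncation[OF p y \<delta>] by metis
    let ?h = "\<lambda>n. if n \<in> F then y n else 0"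
    obtain z where z: "z \<in> ?A" "l1_le (?h - z) (\<epsilon> / 8)"
      using fin[OF F, of y] \<delta> unfolding l1_closure_def by blast
    have "seq_norm p (?t + (?h - z)) \<le> 4 * (\<epsilon> / 8)"
      using l1_le_imp_seq_norm_le[OF z(2) p] t by (intro seq_norm_add_le[OF p]) auto
    moreover have "?t + (?h - z) = y - z" by (auto simp: fun_eq_iff)
    ultimately show ?thesis
      using z(1) \<epsilon> by (intro bexI[of _ z]) auto
  qed
  ultimately show "cyclic_on (seq_space p) (seq_norm p) (weighted_shift w)"
    unfolding cyclic_on_def by blast
qed

end
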